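(* There is an absolute constant $K>0$ such that the following holds. Let $\mathcal{C}\subset\mathbb{R}^n$ be a nonempty compact convex set with $\ell_2$-diameter $D_2=\max_{x,y\in\mathcal{C}}\|x-y\|_2$, $x^*\in\mathcal{C}$, $f(x)=\|x-x^*\|_\infty$ for $x\in\mathbb{R}^n$, let $\epsilon>0$, and set $\beta=\epsilon$. Run the Frank-Wolfe algorithm on $\min_{x\in\mathcal{C}}f_\beta(x)$, where $f_\beta$ is the Moreau envelope of $f$, started at an arbitrary vertex of $\mathcal{C}$, with step sizes $\gamma_t=\frac{2}{t+2}$ for all $t\in\mathbb{N}$. Then the algorithm produces an iterate $x\in\mathcal{C}$ satisfying $\|x-x^*\|_\infty\leq\epsilon$ whose cardinality is $\mathcal{O}(D_2^2/\epsilon^2)$, i.e. at most $K\max\{1,D_2^2/\epsilon^2\}$.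
   Context: $\langle\cdot,\cdot\rangle$ is the Euclidean inner product on $\mathbb{R}^n$. Vertices of $\mathcal{C}$ are its extreme points. For a convex continuous $f\colon\mathbb{R}^n\to\mathbb{R}$ and $\beta>0$, the Moreau envelope is $f_\beta(x)=\min_{y\in\mathbb{R}^n}f(y)+\frac{1}{2\beta}\|x-y\|_2^2$; it is convex and differentiable with $\nabla f_\beta(x)=\frac1\beta(x-\operatorname{prox}_{\beta f}(x))$, where $\operatorname{prox}_{g}(x)=\arg\min_{y\in\mathbb{R}^n}g(y)+\frac12\|x-y\|_2^2$. Frank-Wolfe algorithm on $\min_{x\in\mathcal{C}}f_\beta(x)$: start at a vertex $x_0$ of $\mathcal{C}$; for $t=0,1,2,\ldots$ let $v_t$ be a vertex of $\mathcal{C}$ belonging to $\arg\min_{v\in\mathcal{C}}\langle v,\nabla f_\beta(x_t)\rangle$, and set $x_{t+1}=x_t+\gamma_t(v_t-x_t)$. Each iterate $x_{t+1}=(1-\gamma_t)x_t+\gamma_tv_t$ comes with an explicit convex decomposition over $x_0,v_0,\ldots,v_t$. The cardinality of an iterate is the number of distinct vertices with positive weight in this decomposition. *)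

theory Defs
  imports "HOL-Analysis.Analysis"
begin

(* The constant K must not depend on the dimension n, so n has to be quantified inside the
   statement and cannot be a type parameter as in real^'n.  All the spaces R^n are therefore taken
   as subspaces of one inner product space: the finitely supported real sequences with the
   Euclidean inner product.  In particular norm, dist, compact and has_derivative refer to the
   Euclidean norm. *)

typedef fseq = "{a :: nat \<Rightarrow> real. finite {i. a i \<noteq> 0}}"
  morphisms coord Abs_fseq
  by (rule exI[of _ "\<lambda>_. 0"]) simp

lemma finite_coord: "finite {i. coord x i \<noteq> 0}"
  using coord[of x] by simp

lemma coord_Abs_fseq: "finite {i. a i \<noteq> 0} \<Longrightarrow> coord (Abs_fseq a) = a"
  by (simp add: Abs_fseq_inverse)

lemma fseq_eq_iff: "x = y \<longleftrightarrow> (\<forall>i. coord x i = coord y i)"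
  by (simp add: coord_inject[symmetric] fun_eq_iff)

instantiation fseq :: real_vector
begin

definition "0 = Abs_fseq (\<lambda>i. 0)"
definition "x + y = Abs_fseq (\<lambda>i. coord x i + coord y i)"
definition "x - y = Abs_fseq (\<lambda>i. coord x i - coord y i)"
definition "- x = Abs_fseq (\<lambda>i. - coord x i)"
definition "c *\<^sub>R x = Abs_fseq (\<lambda>i. c * coord x i)"

lemma coord_zero [simp]: "coord 0 i = 0"
  by (simp add: zero_fseq_def coord_Abs_fseq)

lemma coord_add [simp]: "coord (x + y) i = coord x i + coord y i"
proof -
  have "finite {i. coord x i + coord y i \<noteq> 0}"
    by (rule finite_subset[OF _ finite_UnI[OF finite_coord[of x] finite_coord[of y]]]) auto
  then show ?thesis by (simp add: plus_fseq_def coord_Abs_fseq)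
qed

lemma coord_diff [simp]: "coord (x - y) i = coord x i - coord y i"
proof -
  have "finite {i. coord x i - coord y i \<noteq> 0}"
    by (rule finite_subset[OF _ finite_UnI[OF finite_coord[of x] finite_coord[of y]]]) auto
  then show ?thesis by (simp add: minus_fseq_def coord_Abs_fseq)
qed

lemma coord_uminus [simp]: "coord (- x) i = - coord x i"
  by (simp add: uminus_fseq_def coord_Abs_fseq finite_coord)

lemma coord_scaleR [simp]: "coord (c *\<^sub>R x) i = c * coord x i"
proof -
  have "finite {i. c * coord x i \<noteq> 0}"
    by (rule finite_subset[OF _ finite_coord[of x]]) auto
  then show ?thesis by (simp add: scaleR_fseq_def coord_Abs_fseq)
qed

instance
  by standard (simp_all add: fseq_eq_iff algebra_simps)

end

instantiation fseq :: real_inner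
begin

definition "x \<bullet> y = (\<Sum>i | coord x i \<noteq> 0. coord x i * coord y i)"
definition "norm (x :: fseq) = sqrt (x \<bullet> x)"
definition "dist (x :: fseq) y = norm (x - y)"
definition "sgn (x :: fseq) = x /\<^sub>R norm x"
definition "(uniformity :: (fseq \<times> fseq) filter) =
  (INF e\<in>{0<..}. principal {(x, y). dist x y < e})"
definition "open (U :: fseq set) \<longleftrightarrow>
  (\<forall>x\<in>U. eventually (\<lambda>(x', y). x' = x \<longrightarrow> y \<in> U) uniformity)"

lemma inner_fseq_eq:
  assumes "finite A" "\<And>i. i \<notin> A \<Longrightarrow> coord x i = 0"
  shows "x \<bullet> y = (\<Sum>i\<in>A. coord x i * coord y i)"
  unfolding inner_fseq_def using assms by (intro sum.mono_neutral_left) auto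

instance
proof
  fix x y z :: fseq and r :: real
  define A where "A = {i. coord x i \<noteq> 0} \<union> {i. coord y i \<noteq> 0} \<union> {i. coord z i \<noteq> 0}"
  have A: "finite A" by (simp add: A_def finite_coord)
  have x: "x \<bullet> w = (\<Sum>i\<in>A. coord x i * coord w i)"
    and y: "y \<bullet> w = (\<Sum>i\<in>A. coord y i * coord w i)"
    and xy: "(x + y) \<bullet> w = (\<Sum>i\<in>A. coord (x + y) i * coord w i)"
    and rx: "(r *\<^sub>R x) \<bullet> w = (\<Sum>i\<in>A. coord (r *\<^sub>R x) i * coord w i)" for w
    by (rule inner_fseq_eq[OF A]; simp add: A_def)+
  show "dist x y = norm (x - y)" by (rule dist_fseq_def)
  show "sgn x = x /\<^sub>R norm x" by (rule sgn_fseq_def)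
  show "norm x = sqrt (x \<bullet> x)" by (rule norm_fseq_def)
  show "x \<bullet> y = y \<bullet> x" by (simp add: x y mult.commute)
  show "(x + y) \<bullet> z = x \<bullet> z + y \<bullet> z"
    by (simp add: x y xy distrib_right sum.distrib)
  show "(r *\<^sub>R x) \<bullet> y = r * (x \<bullet> y)"
    by (simp add: x rx sum_distrib_left mult.assoc)
  show "0 \<le> x \<bullet> x" by (simp add: x sum_nonneg)
  have "x \<bullet> x = 0 \<longleftrightarrow> (\<forall>i\<in>A. coord x i = 0)"
    by (simp add: x A sum_nonneg_eq_0_iff)
  also have "\<dots> \<longleftrightarrow> x = 0" by (auto simp: fseq_eq_iff A_def)
  finally show "x \<bullet> x = 0 \<longleftrightarrow> x = 0" .
qed (rule uniformity_fseq_def open_fseq_def)+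

end

definition Rn :: "nat \<Rightarrow> fseq set"
  where "Rn n = {x. \<forall>i\<ge>n. coord x i = 0}"

definition linf_norm :: "fseq \<Rightarrow> real"
  where "linf_norm x = (SUP i. \<bar>coord x i\<bar>)"

(* The next three facts justify the identification with coordinate space. *)

lemma Rn_ex1: "\<exists>!x. x \<in> Rn n \<and> (\<forall>i<n. coord x i = a i)"
proof -
  have "finite {i. (if i < n then a i else 0) \<noteq> (0::real)}"
    by (rule finite_subset[of _ "{..<n}"]) (auto split: if_splits)
  then have c: "coord (Abs_fseq (\<lambda>i. if i < n then a i else 0)) = (\<lambda>i. if i < n then a i else 0)"
    by (rule coord_Abs_fseq)
  show ?thesis
  proof (rule ex1I)
    show "Abs_fseq (\<lambda>i. if i < n then a i else 0) \<in> Rn n \<and>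
        (\<forall>i<n. coord (Abs_fseq (\<lambda>i. if i < n then a i else 0)) i = a i)"
      by (simp add: Rn_def c)
  qed (auto simp: Rn_def fseq_eq_iff c)
qed

lemma inner_Rn: "x \<in> Rn n \<Longrightarrow> x \<bullet> y = (\<Sum>i<n. coord x i * coord y i)"
  by (rule inner_fseq_eq) (auto simp: Rn_def)

lemma linf_norm_Rn:
  assumes "x \<in> Rn n" "n > 0"
  shows "linf_norm x = Max ((\<lambda>i. \<bar>coord x i\<bar>) ` {..<n})"
  unfolding linf_norm_def
proof (rule cSup_eq_maximum)
  have "Max ((\<lambda>i. \<bar>coord x i\<bar>) ` {..<n}) \<in> (\<lambda>i. \<bar>coord x i\<bar>) ` {..<n}"
    using assms(2) by (intro Max_in) auto
  then show "Max ((\<lambda>i. \<bar>coord x i\<bar>) ` {..<n}) \<in> range (\<lambda>i. \<bar>coord x i\<bar>)" by blast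
next
  fix r assume "r \<in> range (\<lambda>i. \<bar>coord x i\<bar>)"
  then obtain i where r: "r = \<bar>coord x i\<bar>" by blast
  have le: "\<bar>coord x j\<bar> \<le> Max ((\<lambda>i. \<bar>coord x i\<bar>) ` {..<n})" if "j < n" for j
    using that by (intro Max_ge) auto
  show "r \<le> Max ((\<lambda>i. \<bar>coord x i\<bar>) ` {..<n})"
  proof (cases "i < n")
    case True
    then show ?thesis using le r by simp
  next
    case False
    then have "r = 0" using assms(1) r by (simp add: Rn_def)
    then show ?thesis using le[OF assms(2)] abs_ge_zero[of "coord x 0"] by linarith
  qed
qed

(* For convex continuous f and \<beta> > 0 the infimum is a minimum. *)
definition moreau :: "nat \<Rightarrow> real \<Rightarrow> (fseq \<Rightarrow> real) \<Rightarrow> fseq \<Rightarrow> real"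
  where "moreau n \<beta> f x = (INF y\<in>Rn n. f y + 1 / (2 * \<beta>) * (norm (x - y))\<^sup>2)"

(* The gradient in R^n: both the increments and the representing vector stay in Rn n. *)
definition gradient :: "nat \<Rightarrow> (fseq \<Rightarrow> real) \<Rightarrow> fseq \<Rightarrow> fseq"
  where "gradient n F x =
    (THE g. g \<in> Rn n \<and> (F has_derivative (\<lambda>h. g \<bullet> h)) (at x within Rn n))"

(* x and v are the iterates and the selected vertices of some run; the start vertex and the
   choice among several minimizing vertices are left open. *)
definition frank_wolfe ::
    "nat \<Rightarrow> fseq set \<Rightarrow> (fseq \<Rightarrow> real) \<Rightarrow> (nat \<Rightarrow> real) \<Rightarrow> (nat \<Rightarrow> fseq) \<Rightarrow> (nat \<Rightarrow> fseq) \<Rightarrow> bool"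
  where "frank_wolfe n C F \<gamma> x v \<longleftrightarrow>
    x 0 extreme_point_of C \<and>
    (\<forall>t. v t extreme_point_of C \<and>
         is_arg_min (\<lambda>w. w \<bullet> gradient n F (x t)) (\<lambda>w. w \<in> C) (v t) \<and>
         x (Suc t) = x t + \<gamma> t *\<^sub>R (v t - x t))"

(* fw_weight \<gamma> x0 v t u is the total weight of the point u in the decomposition of the t-th
   iterate over x0, v 0, ..., v (t - 1) that results from unfolding
   x (Suc t) = (1 - \<gamma> t) x t + \<gamma> t v t; repeated vertices are merged. *)
primrec fw_weight :: "(nat \<Rightarrow> real) \<Rightarrow> fseq \<Rightarrow> (nat \<Rightarrow> fseq) \<Rightarrow> nat \<Rightarrow> fseq \<Rightarrow> real"
  where
    "fw_weight \<gamma> x0 v 0 = (\<lambda>u. if u = x0 then 1 else 0)"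
  | "fw_weight \<gamma> x0 v (Suc t) =
      (\<lambda>u. (1 - \<gamma> t) * fw_weight \<gamma> x0 v t u + (if u = v t then \<gamma> t else 0))"

definition fw_cardinality :: "(nat \<Rightarrow> real) \<Rightarrow> fseq \<Rightarrow> (nat \<Rightarrow> fseq) \<Rightarrow> nat \<Rightarrow> nat"
  where "fw_cardinality \<gamma> x0 v t = card {u. fw_weight \<gamma> x0 v t u > 0}"

end

theory Submission
  imports Defs
begin

text \<open>
  The function \<open>f z = \<parallel>z - x\<^sup>*\<parallel>\<^sub>\<infinity>\<close> is convex and, because the maximum norm is below the
  Euclidean one, \<open>1\<close>-Lipschitz in the Euclidean norm.  For every convex \<open>L\<close>-Lipschitz function the
  Moreau envelope lies between \<open>f - L\<^sup>2 \<beta> / 2\<close> and \<open>f\<close>, is convex, and is smooth with constant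
  \<open>1 / \<beta>\<close> (\<open>le_moreau\<close>, \<open>moreau_le\<close>, \<open>moreau_gradient\<close>).  For a convex objective that is smooth with
  constant \<open>1 / \<beta>\<close>, Frank-Wolfe with steps \<open>2 / (t + 2)\<close> has primal gap at most
  \<open>2 D\<^sup>2 / (\<beta> (t + 2))\<close> for \<open>t \<ge> 1\<close> (\<open>frank_wolfe_rate\<close>).  The envelope is at most \<open>f x\<^sup>* = 0\<close> at
  \<open>x\<^sup>*\<close>, so with \<open>\<beta> = \<epsilon>\<close> the value \<open>f (x t)\<close> is at most \<open>\<epsilon> / 2 + 2 D\<^sup>2 / (\<epsilon> (t + 2))\<close>,
  which is at most \<open>\<epsilon>\<close> once \<open>t + 2 \<ge> 4 D\<^sup>2 / \<epsilon>\<^sup>2\<close>.  The \<open>t\<close>-th iterate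
  is a combination of at most
  \<open>t + 1\<close> vertices, so \<open>t = \<lceil>4 D\<^sup>2 / \<epsilon>\<^sup>2\<rceil> + 1\<close> gives the required cardinality, and nothing in the
  estimate depends on the dimension.

  The differentiability of the envelope is obtained without any subdifferential calculus.  A proximal
  point \<open>p\<close> of \<open>x\<close> gives the quadratic upper bound
  \<open>f p + \<parallel>z - p\<parallel>\<^sup>2 / (2 \<beta>)\<close> on the envelope, touching it at \<open>x\<close>; reflecting this bound at \<open>x\<close>
  by convexity gives a lower bound with the same linear part.
\<close>

section \<open>The maximum norm\<close>

lemma abs_coord_le_norm: "\<bar>coord z i\<bar> \<le> norm z"
proof (cases "coord z i = 0")
  case False
  have "(coord z i)\<^sup>2 \<le> (\<Sum>j | coord z j \<noteq> 0. coord z j * coord z j)"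
    unfolding power2_eq_square
    by (rule member_le_sum[where f = "\<lambda>j. coord z j * coord z j"])
      (use False in \<open>auto simp: finite_coord\<close>)
  also have "\<dots> = (norm z)\<^sup>2"
    by (simp add: power2_norm_eq_inner inner_fseq_def)
  finally show ?thesis
    using abs_le_square_iff[of "coord z i" "norm z"] by simp
qed simp

lemma bdd_above_abs_coord: "bdd_above (range (\<lambda>i. \<bar>coord z i\<bar>))"
  by (rule bdd_aboveI2) (rule abs_coord_le_norm)

lemma abs_coord_le_linf_norm: "\<bar>coord z i\<bar> \<le> linf_norm z"
  unfolding linf_norm_def by (rule cSUP_upper[OF _ bdd_above_abs_coord]) simp

lemma linf_norm_leI: "(\<And>i. \<bar>coord z i\<bar> \<le> M) \<Longrightarrow> linf_norm z \<le> M"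
  unfolding linf_norm_def by (rule cSUP_least) auto

lemma linf_norm_le_norm: "linf_norm z \<le> norm z"
  by (intro linf_norm_leI abs_coord_le_norm)

lemma linf_norm_zero [simp]: "linf_norm 0 = 0"
  by (simp add: linf_norm_def)

lemma linf_norm_add_le: "linf_norm (a + b) \<le> linf_norm a + linf_norm b"
proof (rule linf_norm_leI)
  fix i
  show "\<bar>coord (a + b) i\<bar> \<le> linf_norm a + linf_norm b"
    using abs_coord_le_linf_norm[of a i] abs_coord_le_linf_norm[of b i] by simp
qed

lemma linf_norm_scaleR_le: "linf_norm (c *\<^sub>R a) \<le> \<bar>c\<bar> * linf_norm a"
  by (rule linf_norm_leI) (simp add: abs_mult mult_left_mono abs_coord_le_linf_norm)

lemma convex_on_linf_norm_diff: "convex S \<Longrightarrow> convex_on S (\<lambda>z. linf_norm (z - a))"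
proof (rule convex_onI)
  fix t :: real and x y :: fseq
  assume t: "0 < t" "t < 1"
  have "(1 - t) *\<^sub>R x + t *\<^sub>R y - a = (1 - t) *\<^sub>R (x - a) + t *\<^sub>R (y - a)"
    by (simp add: algebra_simps)
  then show "linf_norm ((1 - t) *\<^sub>R x + t *\<^sub>R y - a)
      \<le> (1 - t) * linf_norm (x - a) + t * linf_norm (y - a)"
    using linf_norm_add_le[of "(1 - t) *\<^sub>R (x - a)" "t *\<^sub>R (y - a)"]
      linf_norm_scaleR_le[of "1 - t" "x - a"] linf_norm_scaleR_le[of t "y - a"] t
    by simp
qed

lemma lipschitz_on_linf_norm_diff: "1-lipschitz_on S (\<lambda>z. linf_norm (z - a))"
proof (rule lipschitz_onI)
  fix x y :: fseq
  have le: "linf_norm (u - a) - linf_norm (w - a) \<le> norm (u - w)" for u w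
    using linf_norm_add_le[of "w - a" "u - w"] linf_norm_le_norm[of "u - w"] by simp
  show "dist (linf_norm (x - a)) (linf_norm (y - a)) \<le> 1 * dist x y"
    using le[of x y] le[of y x] by (simp add: dist_norm norm_minus_commute abs_le_iff)
qed simp

section \<open>Compactness in coordinate space\<close>

lemma subspace_Rn: "subspace (Rn n)"
  by (auto simp: Rn_def subspace_def)

lemma coord_axis:
  "coord (Abs_fseq (\<lambda>i. if i = n then 1 else 0)) j = (if j = n then 1 else 0)"
  by (subst coord_Abs_fseq) (auto intro: finite_subset[of _ "{n}"])

text \<open>The ambient space of all finitely supported sequences is infinite-dimensional, so compactness
  has to come from the dimension bound: the cube in dimension \<open>n + 1\<close> is the continuous image of
  the cube in dimension \<open>n\<close> times an interval.\<close>

lemma compact_cube_Rn: "compact {y \<in> Rn n. \<forall>i. \<bar>coord y i\<bar> \<le> M}" (is "compact (?Q n)")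
proof (cases "M \<ge> 0")
  case False
  then have "?Q n = {}"
    by auto
  then show ?thesis by (simp only: compact_empty)
next
  case M: True
  show ?thesis
  proof (induction n)
    case 0
    have "?Q 0 = {0}" using M by (auto simp: Rn_def fseq_eq_iff)
    then show ?case by (simp only: compact_sing)
  next
    case (Suc n)
    define e where "e = Abs_fseq (\<lambda>i. if i = n then 1 else 0)"
    have e: "coord e j = (if j = n then 1 else 0)" for j
      unfolding e_def by (rule coord_axis)
    let ?h = "\<lambda>(y, c). y + c *\<^sub>R e"
    have "?Q (Suc n) = ?h ` (?Q n \<times> {-M..M})"
    proof (intro set_eqI iffI)
      fix z assume z: "z \<in> ?Q (Suc n)"
      have "z = ?h (z - coord z n *\<^sub>R e, coord z n)" by simp
      moreover have "z - coord z n *\<^sub>R e \<in> ?Q n"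
        using z M by (auto simp: Rn_def e le_Suc_eq Suc_le_eq)
      moreover have "coord z n \<in> {-M..M}"
        using z by (auto simp: abs_le_iff dest: spec[of _ n])
      ultimately show "z \<in> ?h ` (?Q n \<times> {-M..M})" by blast
    next
      fix z assume "z \<in> ?h ` (?Q n \<times> {-M..M})"
      then obtain y c where yc: "y \<in> ?Q n" "c \<in> {-M..M}" "z = y + c *\<^sub>R e" by auto
      then show "z \<in> ?Q (Suc n)"
        by (auto simp: Rn_def e)
    qed
    moreover have "compact (?h ` (?Q n \<times> {-M..M}))"
      unfolding case_prod_unfold
      by (intro compact_continuous_image compact_Times Suc.IH compact_Icc continuous_intros)
    ultimately show ?case by simp
  qed
qed

lemma compact_Rn_cball: "compact (Rn n \<inter> cball x r)"
proof -
  have "\<bar>coord y i\<bar> \<le> norm x + r" if "y \<in> cball x r" for y i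
  proof -
    have "norm y \<le> norm x + norm (y - x)"
      using norm_triangle_ineq[of x "y - x"] by simp
    then show ?thesis
      using that abs_coord_le_norm[of y i] by (simp add: dist_norm norm_minus_commute)
  qed
  then have "Rn n \<inter> cball x r = {y \<in> Rn n. \<forall>i. \<bar>coord y i\<bar> \<le> norm x + r} \<inter> cball x r"
    by auto
  then show ?thesis
    by (simp only: compact_Int_closed[OF compact_cube_Rn closed_cball])
qed

section \<open>The Moreau envelope\<close>

text \<open>Completing the square in \<open>\<parallel>x - y\<parallel>\<close> bounds the decrease of \<open>f\<close> allowed by the Lipschitz
  condition against the quadratic penalty.\<close>

lemma lipschitz_penalty_ge:
  assumes "L-lipschitz_on S f" "\<beta> > 0" "x \<in> S" "y \<in> S"
  shows "f x - L\<^sup>2 * \<beta> / 2 \<le> f y + 1 / (2 * \<beta>) * (norm (x - y))\<^sup>2"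
proof -
  have "f x - f y \<le> L * norm (x - y)"
    using lipschitz_onD[OF assms(1,3,4)] by (simp add: dist_norm abs_le_iff)
  moreover have "L * norm (x - y) \<le> L\<^sup>2 * \<beta> / 2 + 1 / (2 * \<beta>) * (norm (x - y))\<^sup>2"
  proof -
    have "0 \<le> 1 / (2 * \<beta>) * (norm (x - y) - L * \<beta>)\<^sup>2"
      using assms(2) by simp
    also have "\<dots> = 1 / (2 * \<beta>) * (norm (x - y))\<^sup>2 + L\<^sup>2 * \<beta> / 2 - L * norm (x - y)"
      using assms(2) by (simp add: field_simps power2_eq_square)
    finally show ?thesis by simp
  qed
  ultimately show ?thesis by linarith
qed

lemma moreau_le_value:
  assumes "L-lipschitz_on (Rn n) f" "\<beta> > 0" "x \<in> Rn n" "y \<in> Rn n"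
  shows "moreau n \<beta> f x \<le> f y + 1 / (2 * \<beta>) * (norm (x - y))\<^sup>2"
proof -
  let ?\<phi> = "\<lambda>y. f y + 1 / (2 * \<beta>) * (norm (x - y))\<^sup>2"
  have "bdd_below (?\<phi> ` Rn n)"
  proof (rule bdd_belowI2)
    fix y assume "y \<in> Rn n"
    then show "f x - L\<^sup>2 * \<beta> / 2 \<le> ?\<phi> y"
      by (rule lipschitz_penalty_ge[OF assms(1-3)])
  qed
  then show ?thesis
    unfolding moreau_def using assms(4) by (rule cINF_lower)
qed

lemma moreau_le:
  assumes "L-lipschitz_on (Rn n) f" "\<beta> > 0" "x \<in> Rn n"
  shows "moreau n \<beta> f x \<le> f x"
  using moreau_le_value[OF assms assms(3)] by simp

lemma le_moreau:
  assumes "L-lipschitz_on (Rn n) f" "\<beta> > 0" "x \<in> Rn n"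
  shows "f x \<le> moreau n \<beta> f x + L\<^sup>2 * \<beta> / 2"
proof -
  have "f x - L\<^sup>2 * \<beta> / 2 \<le> moreau n \<beta> f x"
    unfolding moreau_def
  proof (rule cINF_greatest)
    show "Rn n \<noteq> {}" using assms(3) by blast
    fix y assume "y \<in> Rn n"
    then show "f x - L\<^sup>2 * \<beta> / 2 \<le> f y + 1 / (2 * \<beta>) * (norm (x - y))\<^sup>2"
      by (rule lipschitz_penalty_ge[OF assms])
  qed
  then show ?thesis by simp
qed

text \<open>Points farther than \<open>2 L \<beta>\<close> from \<open>x\<close> have a larger penalized value than \<open>x\<close> itself, so the
  minimum over the compact ball of that radius is global.\<close>

lemma prox_exists:
  assumes lip: "L-lipschitz_on (Rn n) f" and \<beta>: "\<beta> > 0" and x: "x \<in> Rn n"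
  obtains p where "p \<in> Rn n" "moreau n \<beta> f x = f p + 1 / (2 * \<beta>) * (norm (x - p))\<^sup>2"
proof -
  let ?\<phi> = "\<lambda>y. f y + 1 / (2 * \<beta>) * (norm (x - y))\<^sup>2"
  let ?B = "Rn n \<inter> cball x (2 * L * \<beta>)"
  have L: "L \<ge> 0" using lip by (rule lipschitz_on_nonneg)
  have xB: "x \<in> ?B" using L \<beta> x by simp
  have "continuous_on ?B f"
    using lipschitz_on_continuous_on[OF lip] continuous_on_subset by blast
  then have "continuous_on ?B ?\<phi>"
    by (intro continuous_intros)
  then obtain p where p: "p \<in> ?B" and min: "\<forall>y\<in>?B. ?\<phi> p \<le> ?\<phi> y"
    using continuous_attains_inf[OF compact_Rn_cball, of n x "2 * L * \<beta>" ?\<phi>] xB by blast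
  have glob: "?\<phi> p \<le> ?\<phi> y" if y: "y \<in> Rn n" for y
  proof (cases "y \<in> ?B")
    case False
    then have far: "2 * L * \<beta> \<le> norm (x - y)" using y by (simp add: dist_norm)
    have "f x - f y \<le> L * norm (x - y)"
      using lipschitz_onD[OF lip x y] by (simp add: dist_norm abs_le_iff)
    also have "\<dots> \<le> 1 / (2 * \<beta>) * (norm (x - y))\<^sup>2"
      using mult_right_mono[OF far, of "norm (x - y)"] \<beta> by (simp add: field_simps power2_eq_square)
    finally have "?\<phi> x \<le> ?\<phi> y" by simp
    with bspec[OF min xB] show ?thesis by (rule order_trans)
  qed (use min in blast)
  have "moreau n \<beta> f x = ?\<phi> p"
    unfolding moreau_def
    by (rule cInf_eq_minimum) (use p glob in auto)
  then show thesis using that p by blast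
qed

text \<open>The penalized function is jointly convex in the centre and the competitor, and minimizing a
  jointly convex function over one variable preserves convexity: the convex combination of two
  proximal points is a competitor for the combination of the centres.\<close>

lemma convex_on_moreau:
  assumes conv: "convex_on (Rn n) f" and lip: "L-lipschitz_on (Rn n) f" and \<beta>: "\<beta> > 0"
  shows "convex_on (Rn n) (moreau n \<beta> f)"
proof (rule convex_onI)
  fix t :: real and x y assume t: "0 < t" "t < 1" and x: "x \<in> Rn n" and y: "y \<in> Rn n"
  obtain p where p: "p \<in> Rn n" "moreau n \<beta> f x = f p + 1 / (2 * \<beta>) * (norm (x - p))\<^sup>2"
    by (rule prox_exists[OF lip \<beta> x])
  obtain q where q: "q \<in> Rn n" "moreau n \<beta> f y = f q + 1 / (2 * \<beta>) * (norm (y - q))\<^sup>2"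
    by (rule prox_exists[OF lip \<beta> y])
  let ?z = "(1 - t) *\<^sub>R x + t *\<^sub>R y" and ?r = "(1 - t) *\<^sub>R p + t *\<^sub>R q"
  have mem: "?z \<in> Rn n" "?r \<in> Rn n"
    using x y p q by (simp_all add: subspace_Rn subspace_add subspace_scale)
  have "?z - ?r = (1 - t) *\<^sub>R (x - p) + t *\<^sub>R (y - q)"
    by (simp add: algebra_simps)
  then have "norm (?z - ?r) \<le> (1 - t) * norm (x - p) + t * norm (y - q)"
    using norm_triangle_ineq[of "(1 - t) *\<^sub>R (x - p)" "t *\<^sub>R (y - q)"] t by simp
  then have "(norm (?z - ?r))\<^sup>2 \<le> ((1 - t) * norm (x - p) + t * norm (y - q))\<^sup>2"
    by (intro power_mono) auto
  also have "\<dots> \<le> (1 - t) * (norm (x - p))\<^sup>2 + t * (norm (y - q))\<^sup>2"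
  proof -
    have "(1 - t) * a\<^sup>2 + t * b\<^sup>2 - ((1 - t) * a + t * b)\<^sup>2 = t * (1 - t) * (a - b)\<^sup>2" for a b :: real
      by (simp add: algebra_simps power2_eq_square)
    moreover have "0 \<le> t * (1 - t) * (a - b)\<^sup>2" for a b :: real
      using t by simp
    ultimately show ?thesis by (metis diff_ge_0_iff_ge)
  qed
  finally have sq: "1 / (2 * \<beta>) * (norm (?z - ?r))\<^sup>2
      \<le> 1 / (2 * \<beta>) * ((1 - t) * (norm (x - p))\<^sup>2 + t * (norm (y - q))\<^sup>2)"
    using \<beta> by (intro mult_left_mono) auto
  have "moreau n \<beta> f ?z \<le> f ?r + 1 / (2 * \<beta>) * (norm (?z - ?r))\<^sup>2"
    by (rule moreau_le_value[OF lip \<beta> mem])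
  also have "\<dots> \<le> ((1 - t) * f p + t * f q)
      + 1 / (2 * \<beta>) * ((1 - t) * (norm (x - p))\<^sup>2 + t * (norm (y - q))\<^sup>2)"
    using convex_onD[OF conv, of t p q] t p q sq by (intro add_mono) auto
  also have "\<dots> = (1 - t) * moreau n \<beta> f x + t * moreau n \<beta> f y"
  proof -
    have "((1 - t) * a + t * b) + k * ((1 - t) * c + t * d)
        = (1 - t) * (a + k * c) + t * (b + k * d)" for a b c d k :: real
      by (simp add: algebra_simps)
    then show ?thesis unfolding p(2) q(2) .
  qed
  finally show "moreau n \<beta> f ?z \<le> (1 - t) * moreau n \<beta> f x + t * moreau n \<beta> f y" .
qed (rule subspace_imp_convex[OF subspace_Rn])

section \<open>Gradients of smooth convex functions\<close>

lemma gradient_eqI: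
  assumes x: "x \<in> Rn n" and g: "g \<in> Rn n"
    and der: "(F has_derivative (\<lambda>h. g \<bullet> h)) (at x within Rn n)"
  shows "gradient n F x = g"
  unfolding gradient_def
proof (rule the_equality)
  show "g \<in> Rn n \<and> (F has_derivative (\<lambda>h. g \<bullet> h)) (at x within Rn n)"
    using g der by blast
next
  fix g' assume g': "g' \<in> Rn n \<and> (F has_derivative (\<lambda>h. g' \<bullet> h)) (at x within Rn n)"
  let ?d = "g' - g"
  \<comment> \<open>Both derivatives restrict to the same derivative along the line in direction \<open>g' - g\<close>.\<close>
  have d: "?d \<in> Rn n" using g g' by (simp add: subspace_Rn subspace_diff)
  have line: "((\<lambda>s. F (x + s *\<^sub>R ?d)) has_derivative (\<lambda>s. k \<bullet> (s *\<^sub>R ?d))) (at 0)"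
    if "(F has_derivative (\<lambda>h. k \<bullet> h)) (at x within Rn n)" for k
  proof -
    have "range (\<lambda>s. x + s *\<^sub>R ?d) \<subseteq> Rn n"
      using x d by (auto simp: subspace_Rn subspace_add subspace_scale)
    then have "(F has_derivative (\<lambda>h. k \<bullet> h))
        (at (x + 0 *\<^sub>R ?d) within range (\<lambda>s. x + s *\<^sub>R ?d))"
      using has_derivative_subset[OF that] by simp
    moreover have "((\<lambda>s. x + s *\<^sub>R ?d) has_derivative (\<lambda>s. s *\<^sub>R ?d)) (at 0)"
      by (auto intro!: derivative_eq_intros)
    ultimately show ?thesis
      by (rule has_derivative_in_compose[rotated])
  qed
  have "(\<lambda>s. g' \<bullet> (s *\<^sub>R ?d)) = (\<lambda>s. g \<bullet> (s *\<^sub>R ?d))"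
    by (rule has_derivative_unique[OF line line]) (use g' der in blast)+
  then have "g' \<bullet> ?d = g \<bullet> ?d" by (metis scaleR_one)
  then have "?d \<bullet> ?d = 0" by (simp add: inner_diff_left)
  then show "g' = g" by simp
qed

lemma has_derivative_quadratic_error:
  fixes F :: "'a::real_inner \<Rightarrow> real"
  assumes "\<And>z. z \<in> S \<Longrightarrow> \<bar>F z - F x - g \<bullet> (z - x)\<bar> \<le> c * (norm (z - x))\<^sup>2"
  shows "(F has_derivative (\<lambda>h. g \<bullet> h)) (at x within S)"
  unfolding has_derivative_within
proof
  show "bounded_linear (\<lambda>h. g \<bullet> h)" by (rule bounded_linear_inner_right)
  show "((\<lambda>y. (1 / norm (y - x)) *\<^sub>R (F y - (F x + g \<bullet> (y - x)))) \<longlongrightarrow> 0) (at x within S)"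
  proof (rule Lim_null_comparison)
    show "\<forall>\<^sub>F y in at x within S.
        norm ((1 / norm (y - x)) *\<^sub>R (F y - (F x + g \<bullet> (y - x)))) \<le> c * norm (y - x)"
      unfolding eventually_at_filter
    proof (intro always_eventually allI impI)
      fix y assume "y \<noteq> x" "y \<in> S"
      then show "norm ((1 / norm (y - x)) *\<^sub>R (F y - (F x + g \<bullet> (y - x)))) \<le> c * norm (y - x)"
        using assms[of y] by (simp add: field_simps power2_eq_square)
    qed
    have "((\<lambda>y. c * norm (y - x)) \<longlongrightarrow> c * norm (x - x)) (at x within S)"
      by (intro tendsto_intros)
    then show "((\<lambda>y. c * norm (y - x)) \<longlongrightarrow> 0) (at x within S)" by simp
  qed
qed

text \<open>A quadratic upper model that touches a convex function at \<open>x\<close> determines the gradient there.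
  Since \<open>x\<close> is the midpoint of \<open>z\<close> and its reflection \<open>2 x - z\<close>, convexity turns the model at the
  reflected point into a lower model at \<open>z\<close>; and a lower model with quadratic error, applied close to
  \<open>x\<close> on the segment to \<open>z\<close>, loses its error by convexity.\<close>

lemma convex_quadratic_upper_model:
  assumes conv: "convex_on (Rn n) F" and x: "x \<in> Rn n" and g: "g \<in> Rn n"
    and up: "\<And>z. z \<in> Rn n \<Longrightarrow> F z \<le> F x + g \<bullet> (z - x) + c * (norm (z - x))\<^sup>2"
  shows "gradient n F x = g" and "z \<in> Rn n \<Longrightarrow> F x + g \<bullet> (z - x) \<le> F z"
proof -
  have low: "F x + g \<bullet> (z - x) - c * (norm (z - x))\<^sup>2 \<le> F z" if z: "z \<in> Rn n" for z
  proof -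
    let ?w = "2 *\<^sub>R x - z"
    have w: "?w \<in> Rn n" using x z by (simp add: subspace_Rn subspace_diff subspace_scale)
    have mid: "(1 - 1/2) *\<^sub>R z + (1/2) *\<^sub>R ?w = x" by (simp add: algebra_simps)
    have "F x \<le> (1 - 1/2) * F z + 1/2 * F ?w"
      using convex_onD[OF conv, of "1/2" z ?w] z w unfolding mid by simp
    moreover have "?w - x = - (z - x)" by (simp add: algebra_simps scaleR_2)
    then have "F ?w \<le> F x - g \<bullet> (z - x) + c * (norm (z - x))\<^sup>2"
      using up[OF w] by (simp only: inner_minus_right norm_minus_cancel)
    ultimately show ?thesis by simp
  qed
  have "(F has_derivative (\<lambda>h. g \<bullet> h)) (at x within Rn n)"
  proof (rule has_derivative_quadratic_error)
    fix z assume "z \<in> Rn n"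
    then show "\<bar>F z - F x - g \<bullet> (z - x)\<bar> \<le> c * (norm (z - x))\<^sup>2"
      using up[of z] low[of z] by (simp add: abs_le_iff)
  qed
  then show "gradient n F x = g" by (rule gradient_eqI[OF x g])
  show "F x + g \<bullet> (z - x) \<le> F z" if z: "z \<in> Rn n"
  proof -
    let ?q = "c * (norm (z - x))\<^sup>2"
    have step: "F x + g \<bullet> (z - x) - s * ?q \<le> F z" if s: "0 < s" "s < 1" for s
    proof -
      let ?y = "(1 - s) *\<^sub>R x + s *\<^sub>R z"
      have y: "?y \<in> Rn n" using x z by (simp add: subspace_Rn subspace_add subspace_scale)
      have yx: "?y - x = s *\<^sub>R (z - x)" by (simp add: algebra_simps)
      have "F x + s * (g \<bullet> (z - x)) - s\<^sup>2 * ?q \<le> F ?y"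
        using low[OF y] unfolding yx by (simp add: power_mult_distrib mult_ac)
      also have "\<dots> \<le> (1 - s) * F x + s * F z"
        using convex_onD[OF conv, of s x z] x z s by simp
      finally have "s * (F x + g \<bullet> (z - x) - s * ?q) \<le> s * F z"
        by (simp add: algebra_simps power2_eq_square)
      then show ?thesis using s by simp
    qed
    have "\<forall>\<^sub>F s in at_right 0. F x + g \<bullet> (z - x) - s * ?q \<le> F z"
      unfolding eventually_at_right_field using step by (auto intro!: exI[of _ 1])
    moreover have "((\<lambda>s. F x + g \<bullet> (z - x) - s * ?q) \<longlongrightarrow> F x + g \<bullet> (z - x) - 0 * ?q) (at_right 0)"
      by (intro tendsto_intros)
    ultimately have "F x + g \<bullet> (z - x) - 0 * ?q \<le> F z"
      by (intro tendsto_upperbound) auto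
    then show ?thesis by simp
  qed
qed

text \<open>The upper model at \<open>x\<close> comes from keeping the proximal point \<open>p\<close> of \<open>x\<close> as a competitor at
  other points; expanding \<open>\<parallel>z - p\<parallel>\<^sup>2\<close> around \<open>x\<close> shows its linear part to be \<open>(x - p) / \<beta>\<close>.\<close>

lemma moreau_gradient:
  assumes conv: "convex_on (Rn n) f" and lip: "L-lipschitz_on (Rn n) f" and \<beta>: "\<beta> > 0"
    and x: "x \<in> Rn n" and z: "z \<in> Rn n"
  shows "moreau n \<beta> f z \<le> moreau n \<beta> f x + gradient n (moreau n \<beta> f) x \<bullet> (z - x)
      + 1 / (2 * \<beta>) * (norm (z - x))\<^sup>2"
    and "moreau n \<beta> f x + gradient n (moreau n \<beta> f) x \<bullet> (z - x) \<le> moreau n \<beta> f z"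
proof -
  let ?F = "moreau n \<beta> f"
  obtain p where p: "p \<in> Rn n" "?F x = f p + 1 / (2 * \<beta>) * (norm (x - p))\<^sup>2"
    by (rule prox_exists[OF lip \<beta> x])
  define g where "g = (1 / \<beta>) *\<^sub>R (x - p)"
  have g: "g \<in> Rn n"
    unfolding g_def using x p by (simp add: subspace_Rn subspace_diff subspace_scale)
  have up: "?F w \<le> ?F x + g \<bullet> (w - x) + 1 / (2 * \<beta>) * (norm (w - x))\<^sup>2" if w: "w \<in> Rn n" for w
  proof -
    have sq: "(norm (w - p))\<^sup>2
        = (norm (x - p))\<^sup>2 + 2 * ((x - p) \<bullet> (w - x)) + (norm (w - x))\<^sup>2"
      by (simp add: power2_norm_eq_inner inner_diff_left inner_diff_right inner_commute)
    have "?F w \<le> f p + 1 / (2 * \<beta>) * (norm (w - p))\<^sup>2"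
      by (rule moreau_le_value[OF lip \<beta> w p(1)])
    also have "\<dots> = ?F x + g \<bullet> (w - x) + 1 / (2 * \<beta>) * (norm (w - x))\<^sup>2"
      unfolding p(2) sq g_def inner_scaleR_left using \<beta> by (simp add: field_simps)
    finally show ?thesis .
  qed
  note model = convex_quadratic_upper_model[OF convex_on_moreau[OF conv lip \<beta>] x g up]
  have grad: "gradient n ?F x = g" by (rule model(1))
  show "?F z \<le> ?F x + gradient n ?F x \<bullet> (z - x) + 1 / (2 * \<beta>) * (norm (z - x))\<^sup>2"
    unfolding grad by (rule up[OF z])
  show "?F x + gradient n ?F x \<bullet> (z - x) \<le> ?F z"
    unfolding grad by (rule model(2)[OF _ z])
qed

section \<open>Convergence of the Frank-Wolfe algorithm\<close>

lemma convex_steps_mem: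
  assumes "convex C" "x 0 \<in> C" "\<And>t. v t \<in> C" "\<And>t. 0 \<le> \<gamma> t" "\<And>t. \<gamma> t \<le> (1::real)"
    and "\<And>t. x (Suc t) = x t + \<gamma> t *\<^sub>R (v t - x t)"
  shows "x t \<in> C"
proof (induction t)
  case (Suc t)
  have "(1 - \<gamma> t) *\<^sub>R x t + \<gamma> t *\<^sub>R v t \<in> C"
    using assms Suc.IH by (intro convexD) auto
  moreover have "x (Suc t) = (1 - \<gamma> t) *\<^sub>R x t + \<gamma> t *\<^sub>R v t"
    by (simp add: assms(6) algebra_simps)
  ultimately show ?case by simp
qed (use assms in simp)

text \<open>The minimizing direction makes the linear term of a step at most \<open>- \<gamma> t\<close> times the gap, so the
  gaps \<open>h t\<close> satisfy \<open>h (t + 1) \<le> (1 - \<gamma> t) h t + (\<gamma> t)\<^sup>2 c D\<^sup>2\<close>.  For \<open>\<gamma> t = 2 / (t + 2)\<close> this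
  recursion preserves \<open>h t \<le> 4 c D\<^sup>2 / (t + 2)\<close> because \<open>(t + 1) (t + 3) \<le> (t + 2)\<^sup>2\<close>.  The first step
  has length \<open>1\<close> and forgets the starting point, whose gap is unrelated to \<open>c D\<^sup>2\<close>; hence the bound
  starts at \<open>x 1\<close>.\<close>

lemma frank_wolfe_rate:
  fixes F :: "'a::real_inner \<Rightarrow> real" and G :: "'a \<Rightarrow> 'a"
  assumes c: "c \<ge> 0"
    and up: "\<And>y z. y \<in> C \<Longrightarrow> z \<in> C \<Longrightarrow> F z \<le> F y + G y \<bullet> (z - y) + c * (norm (z - y))\<^sup>2"
    and low: "\<And>y z. y \<in> C \<Longrightarrow> z \<in> C \<Longrightarrow> F y + G y \<bullet> (z - y) \<le> F z"
    and diam: "\<And>y z. y \<in> C \<Longrightarrow> z \<in> C \<Longrightarrow> norm (z - y) \<le> D"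
    and x: "\<And>t. x t \<in> C" and v: "\<And>t. v t \<in> C" and a: "a \<in> C"
    and min: "\<And>t w. w \<in> C \<Longrightarrow> v t \<bullet> G (x t) \<le> w \<bullet> G (x t)"
    and step: "\<And>t. x (Suc t) = x t + (2 / (real t + 2)) *\<^sub>R (v t - x t)"
  shows "F (x (Suc t)) - F a \<le> 4 * (c * D\<^sup>2) / (real t + 3)"
proof -
  define A where "A = c * D\<^sup>2"
  have A: "A \<ge> 0" using c by (simp add: A_def)
  have rec: "F (x (Suc t)) - F a \<le> (1 - 2 / (real t + 2)) * (F (x t) - F a) + (2 / (real t + 2))\<^sup>2 * A"
    for t
  proof -
    let ?s = "2 / (real t + 2)"
    have d: "x (Suc t) - x t = ?s *\<^sub>R (v t - x t)" by (simp add: step)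
    have "G (x t) \<bullet> (v t - x t) \<le> G (x t) \<bullet> (a - x t)"
      using min[OF a, of t] by (simp add: inner_diff_right inner_commute)
    also have "\<dots> \<le> F a - F (x t)"
      using low[OF x a, of t] by simp
    finally have lin: "?s * (G (x t) \<bullet> (v t - x t)) \<le> ?s * (F a - F (x t))"
      by (intro mult_left_mono) auto
    have "(norm (v t - x t))\<^sup>2 \<le> D\<^sup>2"
      using diam[OF x v, of t t] by (intro power_mono) auto
    then have quad: "?s\<^sup>2 * (c * (norm (v t - x t))\<^sup>2) \<le> ?s\<^sup>2 * A"
      unfolding A_def using c by (intro mult_left_mono) auto
    have "F (x (Suc t)) \<le> F (x t) + ?s * (G (x t) \<bullet> (v t - x t)) + ?s\<^sup>2 * (c * (norm (v t - x t))\<^sup>2)"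
      using up[of "x t" "x (Suc t)", OF x x]
      unfolding d norm_scaleR power_mult_distrib inner_scaleR_right power2_abs
      by (simp only: mult.left_commute)
    also have "\<dots> \<le> F (x t) + ?s * (F a - F (x t)) + ?s\<^sup>2 * A"
      using lin quad by linarith
    finally show ?thesis by (simp only: algebra_simps)
  qed
  have "F (x (Suc t)) - F a \<le> 4 * A / (real t + 3)"
  proof (induction t)
    case 0
    have "F (x (Suc 0)) - F a \<le> A" using rec[of 0] by simp
    also have "A \<le> 4 * A / (real 0 + 3)" using A by simp
    finally show ?case .
  next
    case (Suc t)
    let ?r = "real t + 3"
    have "F (x (Suc (Suc t))) - F a
        \<le> (1 - 2 / ?r) * (F (x (Suc t)) - F a) + (2 / ?r)\<^sup>2 * A"
      using rec[of "Suc t"] by (simp add: add_ac)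
    also have "\<dots> \<le> (1 - 2 / ?r) * (4 * A / ?r) + (2 / ?r)\<^sup>2 * A"
      using Suc.IH by (intro add_right_mono mult_left_mono) (auto simp: field_simps)
    also have "\<dots> = 4 * A * ((?r - 1) / ?r\<^sup>2)"
    proof -
      have "(1 - 2 / r) * (4 * A / r) + (2 / r)\<^sup>2 * A = 4 * A * ((r - 1) / r\<^sup>2)" if "r > 0" for r
        using that by (simp add: divide_simps) (simp add: algebra_simps power2_eq_square)
      then show ?thesis by simp
    qed
    also have "\<dots> \<le> 4 * A * (1 / (?r + 1))"
    proof (rule mult_left_mono)
      have "(?r - 1) * (?r + 1) \<le> ?r\<^sup>2" by (simp add: algebra_simps power2_eq_square)
      then show "(?r - 1) / ?r\<^sup>2 \<le> 1 / (?r + 1)" by (simp add: divide_simps)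
    qed (use A in simp)
    finally show ?case by (simp add: add_ac)
  qed
  then show ?thesis unfolding A_def .
qed

lemma fw_cardinality_le: "fw_cardinality \<gamma> x0 v t \<le> t + 1"
proof -
  have "fw_weight \<gamma> x0 v t u = 0" if "u \<notin> insert x0 (v ` {..<t})" for u
    using that by (induction t) (auto simp: lessThan_Suc)
  then have "{u. fw_weight \<gamma> x0 v t u > 0} \<subseteq> insert x0 (v ` {..<t})"
    by force
  then have "card {u. fw_weight \<gamma> x0 v t u > 0} \<le> card (insert x0 (v ` {..<t}))"
    by (intro card_mono) auto
  also have "\<dots> \<le> t + 1"
    using card_insert_le_m1[of "t + 1" "v ` {..<t}" x0] card_image_le[of "{..<t}" v] by simp
  finally show ?thesis by (simp add: fw_cardinality_def)
qed

section \<open>Approximation in the maximum norm by few vertices\<close>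

lemma frank_wolfe_linf_approx:
  fixes n C a \<epsilon> x v
  defines "f \<equiv> \<lambda>z. linf_norm (z - a)" and "\<gamma> \<equiv> \<lambda>t. 2 / (real t + 2)"
  assumes C: "C \<subseteq> Rn n" and comp: "compact C" and conv: "convex C" and a: "a \<in> C"
    and \<epsilon>: "\<epsilon> > 0" and fw: "frank_wolfe n C (moreau n \<epsilon> f) \<gamma> x v"
  shows "\<exists>t. x t \<in> C \<and> linf_norm (x t - a) \<le> \<epsilon> \<and>
    real (fw_cardinality \<gamma> (x 0) v t) \<le> 7 * max 1 ((diameter C)\<^sup>2 / \<epsilon>\<^sup>2)"
proof -
  let ?F = "moreau n \<epsilon> f" and ?D = "diameter C"
  define q where "q = ?D\<^sup>2 / \<epsilon>\<^sup>2"
  define s where "s = nat \<lceil>4 * q\<rceil>"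
  have q: "q \<ge> 0" by (simp add: q_def)
  have s: "4 * q \<le> real s" "real s \<le> 4 * q + 1"
    unfolding s_def using q by linarith+
  have fconv: "convex_on (Rn n) f"
    unfolding f_def by (rule convex_on_linf_norm_diff[OF subspace_imp_convex[OF subspace_Rn]])
  have flip: "1-lipschitz_on (Rn n) f"
    unfolding f_def by (rule lipschitz_on_linf_norm_diff)
  have v: "v t \<in> C" and step: "x (Suc t) = x t + \<gamma> t *\<^sub>R (v t - x t)" for t
    using fw by (auto simp: frank_wolfe_def extreme_point_of_def)
  have min: "v t \<bullet> gradient n ?F (x t) \<le> w \<bullet> gradient n ?F (x t)" if "w \<in> C" for t w
    using fw that by (auto simp: frank_wolfe_def is_arg_min_def not_less)
  have "x 0 \<in> C" using fw by (auto simp: frank_wolfe_def extreme_point_of_def)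
  then have x: "x t \<in> C" for t
    using convex_steps_mem[where \<gamma> = \<gamma> and x = x and v = v, OF conv] v step by (simp add: \<gamma>_def)
  have "?F (x (Suc s)) - ?F a \<le> 4 * (1 / (2 * \<epsilon>) * ?D\<^sup>2) / (real s + 3)"
  proof (rule frank_wolfe_rate[where C = C and G = "gradient n ?F" and v = v])
    show "0 \<le> 1 / (2 * \<epsilon>)" using \<epsilon> by simp
    show "norm (z - y) \<le> ?D" if "y \<in> C" "z \<in> C" for y z
      using diameter_bounded_bound[OF compact_imp_bounded[OF comp] that(2,1)]
      by (simp add: dist_norm)
    show "?F z \<le> ?F y + gradient n ?F y \<bullet> (z - y) + 1 / (2 * \<epsilon>) * (norm (z - y))\<^sup>2"
      and "?F y + gradient n ?F y \<bullet> (z - y) \<le> ?F z" if "y \<in> C" "z \<in> C" for y z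
      using moreau_gradient[OF fconv flip \<epsilon>, of y z] that C by auto
    show "x (Suc t) = x t + (2 / (real t + 2)) *\<^sub>R (v t - x t)" for t
      using step by (simp add: \<gamma>_def)
  qed (use x v a min in auto)
  also have "\<dots> = 2 * q * \<epsilon> / (real s + 3)"
    using \<epsilon> by (simp add: q_def power2_eq_square)
  also have "\<dots> \<le> \<epsilon> / 2"
  proof -
    have "4 * q * \<epsilon> \<le> (real s + 3) * \<epsilon>"
      using s(1) \<epsilon> by (intro mult_right_mono) auto
    then show ?thesis by (simp add: field_simps)
  qed
  finally have "?F (x (Suc s)) \<le> ?F a + \<epsilon> / 2" by simp
  moreover have "?F a \<le> 0"
    using moreau_le[OF flip \<epsilon>, of a] a C by (auto simp: f_def)
  moreover have "f (x (Suc s)) \<le> ?F (x (Suc s)) + \<epsilon> / 2"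
    using le_moreau[OF flip \<epsilon>, of "x (Suc s)"] x C by auto
  ultimately have "linf_norm (x (Suc s) - a) \<le> \<epsilon>" by (simp add: f_def)
  moreover have "real (fw_cardinality \<gamma> (x 0) v (Suc s)) \<le> 7 * max 1 q"
  proof -
    have "real (fw_cardinality \<gamma> (x 0) v (Suc s)) \<le> real (Suc s + 1)"
      using fw_cardinality_le of_nat_le_iff by blast
    also have "\<dots> \<le> 4 * q + 3" using s(2) by simp
    also have "\<dots> \<le> 7 * max 1 q" by simp
    finally show ?thesis .
  qed
  ultimately show ?thesis using x unfolding q_def by blast
qed

theorem corollary6p9:
  shows "\<exists>K::real. K > 0 \<and>
    (\<forall>(n::nat) (C::fseq set) (xstar::fseq) (f::fseq \<Rightarrow> real) (\<epsilon>::real) (\<beta>::real)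
       (\<gamma>::nat \<Rightarrow> real) (x::nat \<Rightarrow> fseq) (v::nat \<Rightarrow> fseq).
       C \<subseteq> Rn n \<and> C \<noteq> {} \<and> compact C \<and> convex C \<and> xstar \<in> C \<and>
       f = (\<lambda>z. linf_norm (z - xstar)) \<and> \<epsilon> > 0 \<and> \<beta> = \<epsilon> \<and>
       \<gamma> = (\<lambda>t. 2 / (real t + 2)) \<and>
       frank_wolfe n C (moreau n \<beta> f) \<gamma> x v \<longrightarrow>
       (\<exists>t. x t \<in> C \<and> linf_norm (x t - xstar) \<le> \<epsilon> \<and>
            real (fw_cardinality \<gamma> (x 0) v t) \<le> K * max 1 ((diameter C)\<^sup>2 / \<epsilon>\<^sup>2)))"
  using frank_wolfe_linf_approx by (intro exI[of _ "7::real"]) auto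

end
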